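(* Consider the quadrature-based discontinuous Galerkin method given in the context on a periodic domain (no boundary mortar elements), and assume the following constraints. (1) (Approximation consistency) The volume and mortar approximation spaces contain the constants; $\mathbf 1^e$ denotes the degrees of freedom of the constant $1$ on $e$ and $\mathbf 1^m$ the constant $1$ on $m$ at the mortar quadrature nodes. (2) (Projection consistency) For each $m\in\mathbb M$, $\sum_{e\in\mathbb E^{-m}}\mathbf P^{m,e}\mathbf 1^e=\sum_{e\in\mathbb E^{+m}}\mathbf P^{m,e}\mathbf 1^e=\mathbf 1^m$. (3) (Stiffness consistency) $\mathbf S_j^e\mathbf 1^e=\mathbf 0$ for all $e$ and $j$. (4) (Consistent numerical flux) If $v_i^{+m}=v_i^{-m}$ and $T_i^{+m}=T_i^{-m}$ for $i=1,2,3$, then $v_i^{*m}=v_i^{\pm m}$ and $T_i^{*m}=T_i^{\pm m}$. (5) (Discrete divergence theorem) For all $e$ and $j$, $(\mathbf S_j^e)^T\mathbf 1^e=\sum_{m\in\mathbb M^e}(\mathbf P^{m,e})^T\mathbf W^m\mathbf n_j^{m[e]}$. (6) (Consistent constant traction calculation) If for some symmetric constants $\sigma_{ij}\in\mathbb R$ one has $\boldsymbol\sigma_{ij}^e=\sigma_{ij}\mathbf 1^e$ for all $e\in\mathbb E^m$, then $\mathbf T_i^{-m}=\mathbf T_i^{+m}=\sigma_{ij}\mathbf n_j^m$. Then the method is discretely conservative in momentum and strain: every solution satisfies, for all $i,j$, $$\sum_{e\in\mathbb E}(\mathbf 1^e)^T\mathbf M_\rho^e\frac{d\mathbf v_i^e}{dt}=0,\qquad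 \sum_{e\in\mathbb E}(\mathbf 1^e)^T\mathbf M^e_{S_{ijkl}}\frac{d\boldsymbol\sigma_{kl}^e}{dt}=0 .$$
   Context: Conventions: $d\in\{2,3\}$; repeated subscripts $i,j,k,l$ are summed over $1,2,3$; for $d=2$ all objects representing $x_3$-derivatives and normal components $n_3$ are zero. Mesh: $\mathbb E$ is a finite set of volume elements and $\mathbb M$ a finite set of mortar elements partitioning the union of the element boundaries. $\mathbb M^e$ is the set of mortar elements meeting $\partial e$ and $\mathbb E^m=\{e:m\in\mathbb M^e\}$. Each $m$ has a chosen unit normal, and $\mathbb E^m=\mathbb E^{+m}\cup\mathbb E^{-m}$ (disjoint), where $\mathbb E^{+m}$ are the elements on the side toward which the normal points and $\mathbb E^{-m}$ those on the other side. Each element $e$ (mortar $m$) has a reference element $\hat e$ ($\hat m$). Discrete operators: functions in the finite-dimensional space $\hat V^e$ on $\hat e$ are represented by vectors of degrees of freedom (bold, superscript $e$). $\mathbf M_\rho^e$ is the $\rho$-weighted mass matrix, symmetric positive definite. For each $i,j,k,l$, $\mathbf M^e_{S_{ijkl}}$ is the (symmetric) mass matrix weighted by the compliance tensor component $S_{ijkl}$ (possibly variable), so $\mathbf M^e_{S_{ijkl}}=\mathbf M^e_{S_{klij}}=\mathbf M^e_{S_{jikl}}=\mathbf M^e_{S_{ijlk}}$; it is assumed that $(\mathbf s_{ij})^T\mathbf M^e_{S_{ijkl}}\mathbf s_{kl}>0$ for every collection of vectors $\mathbf s_{ij}=\mathbf s_{ji}$ not all zero. $\mathbf S_j^e$ is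 a square stiffness matrix, with $(\mathbf p^e)^T\mathbf S_j^e\mathbf q^e$ approximating $\int_{\hat e}J^ep^e\,\partial q^e/\partial x_j$. On $m$ there is a quadrature rule on $\hat m$ with positive weights $\omega_n^m$; $\mathbf W^m$ is the diagonal matrix with entries $\omega_n^mS_J^m$ evaluated at the $n$-th node, where $S_J^m>0$ is the surface Jacobian determinant. $\mathbf n_j^m$ is the vector of values at the mortar quadrature nodes of the $j$-th component of the unit normal of $m$; $\mathbf n_j^{m[e]}=\mathbf n_j^m$ if $e\in\mathbb E^{-m}$ and $-\mathbf n_j^m$ if $e\in\mathbb E^{+m}$. For $e\in\mathbb E^m$, $\mathbf P^{m,e}$ is a matrix taking degrees of freedom on $e$ to values at the mortar quadrature nodes. $\mathbf P^{m,e}_{n_j}$ is a matrix such that $\mathbf P^{m,e}_{n_j}\boldsymbol\sigma_{ij}^e$ (summed over $j$) is the approximate mortar traction at the quadrature nodes, obtained by multiplying by the unit normal (outward to $e$) before or after projection; one choice is fixed. Mortar states (vectors of values at the mortar quadrature nodes): $\mathbf v_i^{m,e}=\mathbf P^{m,e}\mathbf v_i^e$, $\mathbf T_i^{m,e}=\mathbf P^{m,e}_{n_j}\boldsymbol\sigma^e_{ij}$, $\mathbf v_i^{\pm m}=\sum_{e\in\mathbb E^{\pm m}}\mathbf v_i^{m,e}$, $\mathbf T_i^{\pm m}=\mp\sum_{e\in\mathbb E^{\pm m}}\mathbf T_i^{m,e}$; $\mathbf v_i^{m[e]}=\mathbf v_i^{\pm m}$ if $e\in\mathbb E^{\pm m}$.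 A numerical flux assigns pointwise at each mortar quadrature node values $(T_i^{*m},v_i^{*m})$ as a function of the states $v_i^{\pm m},T_i^{\pm m}$ there, giving $\mathbf T_i^{*m},\mathbf v_i^{*m}$. $\mathbf T_i^{*m[e]}=\mathbf T_i^{*m}$ if $e\in\mathbb E^{-m}$ and $-\mathbf T_i^{*m}$ if $e\in\mathbb E^{+m}$. Method: for each $e\in\mathbb E$ find (differentiable in $t$) $\mathbf v_i^e$ and symmetric $\boldsymbol\sigma_{ij}^e=\boldsymbol\sigma_{ji}^e$ such that $$\mathbf M_\rho^e\frac{d\mathbf v_i^e}{dt}=-(\mathbf S_j^e)^T\boldsymbol\sigma_{ij}^e+\sum_{m\in\mathbb M^e}(\mathbf P^{m,e})^T\mathbf W^m\mathbf T_i^{*m[e]},$$ and, for all symmetric collections of vectors $\boldsymbol\psi_{ij}=\boldsymbol\psi_{ji}$, $$(\boldsymbol\psi_{ij})^T\mathbf M^e_{S_{ijkl}}\frac{d\boldsymbol\sigma_{kl}^e}{dt}=(\boldsymbol\psi_{ij})^T\left[\frac12\left(\mathbf S_j^e\mathbf v_i^e+\mathbf S_i^e\mathbf v_j^e\right)+\sum_{m\in\mathbb M^e}(\mathbf P^{m,e}_{n_j})^T\mathbf W^m(\mathbf v_i^{*m}-\mathbf v_i^{m[e]})\right].$$ *)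

theory Defs
  imports
    Complex_Main
    "HOL-Library.Numeral_Type"
    "Jordan_Normal_Form.Matrix"
begin

text \<open>
  The indices \<open>i, j, k, l\<close> in \<open>1, 2, 3\<close> range over the three-element type \<open>3\<close>, in which the literal
  \<open>3\<close> denotes the same element as \<open>0\<close>. Sums over repeated subscripts are written out.
\<close>

abbreviation vsum :: "nat \<Rightarrow> ('c \<Rightarrow> real vec) \<Rightarrow> 'c set \<Rightarrow> real vec" where
  "vsum n \<equiv> finsum_vec TYPE(real) n"

text \<open>
  The data of the mesh and of the discrete operators. Points of reference elements are vectors with
  \<open>space_dim\<close> entries, points of reference mortars have \<open>space_dim - 1\<close> entries.

  The mesh enters through its incidence relation: \<open>mortars_of e\<close> is $M^e$, and \<open>plus_side m\<close>,
  \<open>minus_side m\<close> are the elements on the side toward which the normal of \<open>m\<close> points and on the other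
  side. A vector \<open>p\<close> of degrees of freedom represents the linear combination of \<open>vol_basis e\<close> with
  coefficients \<open>p\<close>. The matrices are those of the given discretization; they need not be computed by
  exact integration, so only their standing properties are recorded, in \<open>operators_ok\<close>.

  \<open>flux m n vp Tp vm Tm\<close> is the pair of numerical flux values (traction, velocity) at node \<open>n\<close> of \<open>m\<close>,
  for the pointwise states \<open>vp, Tp\<close> on the plus side and \<open>vm, Tm\<close> on the minus side.
\<close>

record ('e, 'm) dg =
  space_dim :: nat
  elements :: "'e set"
  mortars :: "'m set"
  mortars_of :: "'e \<Rightarrow> 'm set"
  plus_side :: "'m \<Rightarrow> 'e set"
  minus_side :: "'m \<Rightarrow> 'e set"
  ref_elem :: "'e \<Rightarrow> real vec set"
  ref_mortar :: "'m \<Rightarrow> real vec set"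
  ndof :: "'e \<Rightarrow> nat"
  vol_basis :: "'e \<Rightarrow> nat \<Rightarrow> real vec \<Rightarrow> real"
  mortar_ndof :: "'m \<Rightarrow> nat"
  mortar_basis :: "'m \<Rightarrow> nat \<Rightarrow> real vec \<Rightarrow> real"
  nquad :: "'m \<Rightarrow> nat"
  quad_node :: "'m \<Rightarrow> nat \<Rightarrow> real vec"
  quad_weight :: "'m \<Rightarrow> nat \<Rightarrow> real"
  surf_jac :: "'m \<Rightarrow> real vec \<Rightarrow> real"
  unit_normal :: "'m \<Rightarrow> 3 \<Rightarrow> real vec \<Rightarrow> real"
  mass_rho :: "'e \<Rightarrow> real mat"
  mass_S :: "'e \<Rightarrow> 3 \<Rightarrow> 3 \<Rightarrow> 3 \<Rightarrow> 3 \<Rightarrow> real mat"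
  stiff :: "'e \<Rightarrow> 3 \<Rightarrow> real mat"
  proj :: "'m \<Rightarrow> 'e \<Rightarrow> real mat"
  nproj :: "'m \<Rightarrow> 'e \<Rightarrow> 3 \<Rightarrow> real mat"
  flux :: "'m \<Rightarrow> nat \<Rightarrow> (3 \<Rightarrow> real) \<Rightarrow> (3 \<Rightarrow> real) \<Rightarrow> (3 \<Rightarrow> real) \<Rightarrow> (3 \<Rightarrow> real)
             \<Rightarrow> (3 \<Rightarrow> real) \<times> (3 \<Rightarrow> real)"

type_synonym 'e velocity = "'e \<Rightarrow> 3 \<Rightarrow> real vec"
type_synonym 'e stress = "'e \<Rightarrow> 3 \<Rightarrow> 3 \<Rightarrow> real vec"

definition elements_of :: "('e, 'm) dg \<Rightarrow> 'm \<Rightarrow> 'e set" where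
  "elements_of G m = {e \<in> elements G. m \<in> mortars_of G e}"

definition lin_comb :: "nat \<Rightarrow> (nat \<Rightarrow> real vec \<Rightarrow> real) \<Rightarrow> real vec \<Rightarrow> real vec \<Rightarrow> real" where
  "lin_comb n \<phi> p x = (\<Sum>a<n. p $ a * \<phi> a x)"

definition lin_indep_on :: "real vec set \<Rightarrow> nat \<Rightarrow> (nat \<Rightarrow> real vec \<Rightarrow> real) \<Rightarrow> bool" where
  "lin_indep_on X n \<phi> \<longleftrightarrow>
     (\<forall>p \<in> carrier_vec n. (\<forall>x \<in> X. lin_comb n \<phi> p x = 0) \<longrightarrow> p = 0\<^sub>v n)"

definition mesh_ok :: "('e, 'm) dg \<Rightarrow> bool" where
  "mesh_ok G \<longleftrightarrow>
     space_dim G \<in> {2, 3} \<and>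
     finite (elements G) \<and> finite (mortars G) \<and>
     (\<forall>e \<in> elements G. mortars_of G e \<subseteq> mortars G) \<and>
     (\<forall>m \<in> mortars G. elements_of G m = plus_side G m \<union> minus_side G m
        \<and> plus_side G m \<inter> minus_side G m = {})"

text \<open>On a periodic domain every mortar element has volume elements on both of its sides.\<close>

definition no_boundary_mortars :: "('e, 'm) dg \<Rightarrow> bool" where
  "no_boundary_mortars G \<longleftrightarrow> (\<forall>m \<in> mortars G. plus_side G m \<noteq> {} \<and> minus_side G m \<noteq> {})"

definition spaces_ok :: "('e, 'm) dg \<Rightarrow> bool" where
  "spaces_ok G \<longleftrightarrow>
     (\<forall>e \<in> elements G. ref_elem G e \<subseteq> carrier_vec (space_dim G) \<and> ref_elem G e \<noteq> {} \<and>
        lin_indep_on (ref_elem G e) (ndof G e) (vol_basis G e)) \<and>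
     (\<forall>m \<in> mortars G. ref_mortar G m \<subseteq> carrier_vec (space_dim G - 1) \<and> ref_mortar G m \<noteq> {} \<and>
        lin_indep_on (ref_mortar G m) (mortar_ndof G m) (mortar_basis G m) \<and>
        (\<forall>n < nquad G m. quad_node G m n \<in> ref_mortar G m \<and> quad_weight G m n > 0) \<and>
        (\<forall>y \<in> ref_mortar G m. surf_jac G m y > 0 \<and> (\<Sum>j \<in> UNIV. (unit_normal G m j y)\<^sup>2) = 1 \<and>
           (space_dim G = 2 \<longrightarrow> unit_normal G m 3 y = 0)))"

definition operators_ok :: "('e, 'm) dg \<Rightarrow> bool" where
  "operators_ok G \<longleftrightarrow>
     (\<forall>e \<in> elements G.
        mass_rho G e \<in> carrier_mat (ndof G e) (ndof G e) \<and>
        transpose_mat (mass_rho G e) = mass_rho G e \<and>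
        (\<forall>p \<in> carrier_vec (ndof G e). p \<noteq> 0\<^sub>v (ndof G e) \<longrightarrow> p \<bullet> (mass_rho G e *\<^sub>v p) > 0) \<and>
        (\<forall>i j k l. mass_S G e i j k l \<in> carrier_mat (ndof G e) (ndof G e) \<and>
           transpose_mat (mass_S G e i j k l) = mass_S G e i j k l \<and>
           mass_S G e i j k l = mass_S G e k l i j \<and>
           mass_S G e i j k l = mass_S G e j i k l \<and>
           mass_S G e i j k l = mass_S G e i j l k) \<and>
        (\<forall>s. (\<forall>i j. s i j \<in> carrier_vec (ndof G e) \<and> s i j = s j i) \<and>
             (\<exists>i j. s i j \<noteq> 0\<^sub>v (ndof G e)) \<longrightarrow>
           (\<Sum>i \<in> UNIV. \<Sum>j \<in> UNIV. \<Sum>k \<in> UNIV. \<Sum>l \<in> UNIV.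
              s i j \<bullet> (mass_S G e i j k l *\<^sub>v s k l)) > 0) \<and>
        (\<forall>j. stiff G e j \<in> carrier_mat (ndof G e) (ndof G e)) \<and>
        (space_dim G = 2 \<longrightarrow> stiff G e 3 = 0\<^sub>m (ndof G e) (ndof G e))) \<and>
     (\<forall>m \<in> mortars G. \<forall>e \<in> elements_of G m.
        proj G m e \<in> carrier_mat (nquad G m) (ndof G e) \<and>
        (\<forall>j. nproj G m e j \<in> carrier_mat (nquad G m) (ndof G e)) \<and>
        (space_dim G = 2 \<longrightarrow> nproj G m e 3 = 0\<^sub>m (nquad G m) (ndof G e)))"

definition dg_setting :: "('e, 'm) dg \<Rightarrow> bool" where
  "dg_setting G \<longleftrightarrow> mesh_ok G \<and> spaces_ok G \<and> operators_ok G"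

definition is_one_dofs :: "('e, 'm) dg \<Rightarrow> 'e \<Rightarrow> real vec \<Rightarrow> bool" where
  "is_one_dofs G e p \<longleftrightarrow> p \<in> carrier_vec (ndof G e) \<and>
     (\<forall>x \<in> ref_elem G e. lin_comb (ndof G e) (vol_basis G e) p x = 1)"

definition mortar_space_has_constants :: "('e, 'm) dg \<Rightarrow> 'm \<Rightarrow> bool" where
  "mortar_space_has_constants G m \<longleftrightarrow> (\<exists>p \<in> carrier_vec (mortar_ndof G m).
     \<forall>y \<in> ref_mortar G m. lin_comb (mortar_ndof G m) (mortar_basis G m) p y = 1)"

definition one_mortar :: "('e, 'm) dg \<Rightarrow> 'm \<Rightarrow> real vec" where
  "one_mortar G m = vec (nquad G m) (\<lambda>n. 1)"

definition W_mat :: "('e, 'm) dg \<Rightarrow> 'm \<Rightarrow> real mat" where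
  "W_mat G m = mat_diag (nquad G m) (\<lambda>n. quad_weight G m n * surf_jac G m (quad_node G m n))"

definition normal_vec :: "('e, 'm) dg \<Rightarrow> 'm \<Rightarrow> 3 \<Rightarrow> real vec" where
  "normal_vec G m j = vec (nquad G m) (\<lambda>n. unit_normal G m j (quad_node G m n))"

text \<open>
  In the names below, \<open>_from\<close> stands for the superscript $m[e]$: the mortar quantity as seen from the
  element \<open>e\<close>.
\<close>

definition normal_from :: "('e, 'm) dg \<Rightarrow> 'm \<Rightarrow> 'e \<Rightarrow> 3 \<Rightarrow> real vec" where
  "normal_from G m e j = (if e \<in> minus_side G m then normal_vec G m j else - normal_vec G m j)"

definition v_elem :: "('e, 'm) dg \<Rightarrow> 'e velocity \<Rightarrow> 'm \<Rightarrow> 'e \<Rightarrow> 3 \<Rightarrow> real vec" where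
  "v_elem G v m e i = proj G m e *\<^sub>v v e i"

definition T_elem :: "('e, 'm) dg \<Rightarrow> 'e stress \<Rightarrow> 'm \<Rightarrow> 'e \<Rightarrow> 3 \<Rightarrow> real vec" where
  "T_elem G \<sigma> m e i = vsum (nquad G m) (\<lambda>j. nproj G m e j *\<^sub>v \<sigma> e i j) UNIV"

definition v_plus :: "('e, 'm) dg \<Rightarrow> 'e velocity \<Rightarrow> 'm \<Rightarrow> 3 \<Rightarrow> real vec" where
  "v_plus G v m i = vsum (nquad G m) (\<lambda>e. v_elem G v m e i) (plus_side G m)"

definition v_minus :: "('e, 'm) dg \<Rightarrow> 'e velocity \<Rightarrow> 'm \<Rightarrow> 3 \<Rightarrow> real vec" where
  "v_minus G v m i = vsum (nquad G m) (\<lambda>e. v_elem G v m e i) (minus_side G m)"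

definition T_plus :: "('e, 'm) dg \<Rightarrow> 'e stress \<Rightarrow> 'm \<Rightarrow> 3 \<Rightarrow> real vec" where
  "T_plus G \<sigma> m i = - vsum (nquad G m) (\<lambda>e. T_elem G \<sigma> m e i) (plus_side G m)"

definition T_minus :: "('e, 'm) dg \<Rightarrow> 'e stress \<Rightarrow> 'm \<Rightarrow> 3 \<Rightarrow> real vec" where
  "T_minus G \<sigma> m i = vsum (nquad G m) (\<lambda>e. T_elem G \<sigma> m e i) (minus_side G m)"

definition v_from :: "('e, 'm) dg \<Rightarrow> 'e velocity \<Rightarrow> 'm \<Rightarrow> 'e \<Rightarrow> 3 \<Rightarrow> real vec" where
  "v_from G v m e i = (if e \<in> minus_side G m then v_minus G v m i else v_plus G v m i)"

definition flux_at ::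
    "('e, 'm) dg \<Rightarrow> 'e velocity \<Rightarrow> 'e stress \<Rightarrow> 'm \<Rightarrow> nat \<Rightarrow> (3 \<Rightarrow> real) \<times> (3 \<Rightarrow> real)" where
  "flux_at G v \<sigma> m n =
     flux G m n (\<lambda>i. v_plus G v m i $ n) (\<lambda>i. T_plus G \<sigma> m i $ n)
                (\<lambda>i. v_minus G v m i $ n) (\<lambda>i. T_minus G \<sigma> m i $ n)"

definition T_star :: "('e, 'm) dg \<Rightarrow> 'e velocity \<Rightarrow> 'e stress \<Rightarrow> 'm \<Rightarrow> 3 \<Rightarrow> real vec" where
  "T_star G v \<sigma> m i = vec (nquad G m) (\<lambda>n. fst (flux_at G v \<sigma> m n) i)"

definition v_star :: "('e, 'm) dg \<Rightarrow> 'e velocity \<Rightarrow> 'e stress \<Rightarrow> 'm \<Rightarrow> 3 \<Rightarrow> real vec" where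
  "v_star G v \<sigma> m i = vec (nquad G m) (\<lambda>n. snd (flux_at G v \<sigma> m n) i)"

definition T_star_from :: "('e, 'm) dg \<Rightarrow> 'e velocity \<Rightarrow> 'e stress \<Rightarrow> 'm \<Rightarrow> 'e \<Rightarrow> 3 \<Rightarrow> real vec" where
  "T_star_from G v \<sigma> m e i =
     (if e \<in> minus_side G m then T_star G v \<sigma> m i else - T_star G v \<sigma> m i)"

definition consistent_flux :: "('e, 'm) dg \<Rightarrow> bool" where
  "consistent_flux G \<longleftrightarrow>
     (\<forall>m \<in> mortars G. \<forall>n < nquad G m. \<forall>vp Tp vm Tm.
        (\<forall>i. vp i = vm i \<and> Tp i = Tm i) \<longrightarrow>
        (\<forall>i. snd (flux G m n vp Tp vm Tm) i = vp i \<and> snd (flux G m n vp Tp vm Tm) i = vm i \<and>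
             fst (flux G m n vp Tp vm Tm) i = Tp i \<and> fst (flux G m n vp Tp vm Tm) i = Tm i))"

definition has_vec_derivative_on :: "nat \<Rightarrow> (real \<Rightarrow> real vec) \<Rightarrow> (real \<Rightarrow> real vec) \<Rightarrow> real set \<Rightarrow> bool" where
  "has_vec_derivative_on n u u' I \<longleftrightarrow>
     (\<forall>t \<in> I. u t \<in> carrier_vec n \<and> u' t \<in> carrier_vec n \<and>
        (\<forall>a < n. ((\<lambda>s. u s $ a) has_real_derivative u' t $ a) (at t within I)))"

definition time_interval :: "real set \<Rightarrow> bool" where
  "time_interval I \<longleftrightarrow> connected I \<and> (\<exists>a \<in> I. \<exists>b \<in> I. a < b)"

text \<open>
  \<open>v, \<sigma>\<close> is a solution on the time interval \<open>I\<close>, with time derivatives \<open>v', \<sigma>'\<close> (which are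
  determined by \<open>v, \<sigma>\<close>, as \<open>I\<close> has no isolated points).
\<close>

definition is_dg_solution ::
    "('e, 'm) dg \<Rightarrow> real set \<Rightarrow> (real \<Rightarrow> 'e velocity) \<Rightarrow> (real \<Rightarrow> 'e velocity) \<Rightarrow>
     (real \<Rightarrow> 'e stress) \<Rightarrow> (real \<Rightarrow> 'e stress) \<Rightarrow> bool" where
  "is_dg_solution G I v v' \<sigma> \<sigma>' \<longleftrightarrow>
     time_interval I \<and>
     (\<forall>e \<in> elements G.
        (\<forall>i. has_vec_derivative_on (ndof G e) (\<lambda>t. v t e i) (\<lambda>t. v' t e i) I) \<and>
        (\<forall>i j. has_vec_derivative_on (ndof G e) (\<lambda>t. \<sigma> t e i j) (\<lambda>t. \<sigma>' t e i j) I) \<and>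
        (\<forall>t \<in> I. \<forall>i j. \<sigma> t e i j = \<sigma> t e j i) \<and>
        (\<forall>t \<in> I. \<forall>i.
           mass_rho G e *\<^sub>v v' t e i =
             - vsum (ndof G e) (\<lambda>j. transpose_mat (stiff G e j) *\<^sub>v \<sigma> t e i j) UNIV
             + vsum (ndof G e)
                 (\<lambda>m. transpose_mat (proj G m e) *\<^sub>v (W_mat G m *\<^sub>v T_star_from G (v t) (\<sigma> t) m e i))
                 (mortars_of G e)) \<and>
        (\<forall>t \<in> I. \<forall>\<psi>. (\<forall>i j. \<psi> i j \<in> carrier_vec (ndof G e) \<and> \<psi> i j = \<psi> j i) \<longrightarrow>
           (\<Sum>i \<in> UNIV. \<Sum>j \<in> UNIV. \<Sum>k \<in> UNIV. \<Sum>l \<in> UNIV.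
              \<psi> i j \<bullet> (mass_S G e i j k l *\<^sub>v \<sigma>' t e k l)) =
           (\<Sum>i \<in> UNIV. \<Sum>j \<in> UNIV.
              \<psi> i j \<bullet>
                ((1 / 2) \<cdot>\<^sub>v (stiff G e j *\<^sub>v v t e i + stiff G e i *\<^sub>v v t e j)
                 + vsum (ndof G e)
                     (\<lambda>m. transpose_mat (nproj G m e j) *\<^sub>v
                            (W_mat G m *\<^sub>v (v_star G (v t) (\<sigma> t) m i - v_from G (v t) m e i)))
                     (mortars_of G e)))))"

end

theory Submission
  imports Defs
begin

text \<open>
  The method is tested with the constant \<open>1\<close>, or, for the strain, with the constant symmetric tensor
  \<open>c\<close> whose only nonzero entries are \<open>1 / 2\<close> at the positions \<open>(p, q)\<close> and \<open>(q, p)\<close> (added up if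
  \<open>p = q\<close>); by the minor symmetry of the compliance it extracts the \<open>(p, q)\<close> strain component.
  On each element the volume terms then disappear or turn into boundary terms
  (\<open>element_momentum_balance\<close>, \<open>element_strain_balance\<close>): stiffness consistency removes the stress
  term, and the discrete divergence theorem rewrites the velocity term as boundary integrals of
  \<open>v\<^sub>i\<close> against the normal. Summing over the elements and reordering the sum by mortars
  (\<open>sum_over_incidences\<close>), it remains to see that each mortar contributes zero.

  For momentum, projection consistency makes the two sides of a mortar receive the same flux with
  opposite signs. For the strain, let \<open>N\<^sub>i\<close> be the traction of the constant stress \<open>c\<close>. By the
  consistency of constant tractions it is the same on both sides, so the minus side contributes
  \<open>\<langle>N\<^sub>i, v\<^sub>i\<^sup>-\<rangle> + \<langle>N\<^sub>i, v\<^sub>i\<^sup>* - v\<^sub>i\<^sup>-\<rangle> = \<langle>N\<^sub>i, v\<^sub>i\<^sup>*\<rangle>\<close> and the plus side the negative of this, by the same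
  calculation; as both sides use the same \<open>v\<^sub>i\<^sup>*\<close>, the two cancel.
\<close>

section \<open>Quadrature inner product on a mortar\<close>

definition mortar_ip :: "('e, 'm) dg \<Rightarrow> 'm \<Rightarrow> real vec \<Rightarrow> real vec \<Rightarrow> real" where
  "mortar_ip G m x y =
     (\<Sum>n<nquad G m. quad_weight G m n * surf_jac G m (quad_node G m n) * (x $ n * y $ n))"

lemma scalar_prod_W_mat:
  assumes "x \<in> carrier_vec (nquad G m)" "y \<in> carrier_vec (nquad G m)"
  shows "x \<bullet> (W_mat G m *\<^sub>v y) = mortar_ip G m x y"
proof -
  have "(W_mat G m *\<^sub>v y) $ n = quad_weight G m n * surf_jac G m (quad_node G m n) * y $ n"
    if "n < nquad G m" for n
  proof -
    have "(W_mat G m *\<^sub>v y) $ n =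
        (\<Sum>k<nquad G m. (if k = n then quad_weight G m k * surf_jac G m (quad_node G m k) else 0) * y $ k)"
      using that assms(2)
      by (auto simp: W_mat_def mat_diag_def scalar_prod_def lessThan_atLeast0 intro!: sum.cong)
    also have "\<dots> = quad_weight G m n * surf_jac G m (quad_node G m n) * y $ n"
      using that by (subst sum.remove[of _ n]) (auto intro!: sum.neutral)
    finally show ?thesis .
  qed
  moreover have "dim_vec (W_mat G m *\<^sub>v y) = nquad G m"
    by (simp add: W_mat_def mat_diag_def)
  ultimately show ?thesis
    unfolding mortar_ip_def scalar_prod_def lessThan_atLeast0 by (simp add: mult.left_commute)
qed

lemma mortar_ip_commute: "mortar_ip G m x y = mortar_ip G m y x"
  by (simp add: mortar_ip_def ac_simps)

lemma mortar_ip_vsum_left: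
  assumes "finite A" "\<And>a. a \<in> A \<Longrightarrow> f a \<in> carrier_vec (nquad G m)"
  shows "mortar_ip G m (vsum (nquad G m) f A) y = (\<Sum>a\<in>A. mortar_ip G m (f a) y)"
  unfolding mortar_ip_def
  by (subst sum.swap)
    (auto intro!: sum.cong simp: index_finsum_vec assms sum_distrib_left sum_distrib_right)

lemma mortar_ip_vsum_right:
  assumes "finite A" "\<And>a. a \<in> A \<Longrightarrow> f a \<in> carrier_vec (nquad G m)"
  shows "mortar_ip G m x (vsum (nquad G m) f A) = (\<Sum>a\<in>A. mortar_ip G m x (f a))"
  using mortar_ip_vsum_left[where y = x, OF assms] by (simp only: mortar_ip_commute[of G m x])

lemma mortar_ip_smult_left:
  "x \<in> carrier_vec (nquad G m) \<Longrightarrow> mortar_ip G m (a \<cdot>\<^sub>v x) y = a * mortar_ip G m x y"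
  by (auto simp: mortar_ip_def sum_distrib_left intro!: sum.cong)

lemma mortar_ip_uminus_left:
  "x \<in> carrier_vec (nquad G m) \<Longrightarrow> mortar_ip G m (- x) y = - mortar_ip G m x y"
  unfolding mortar_ip_def sum_negf[symmetric] by (auto intro!: sum.cong)

lemma mortar_ip_uminus_right:
  "y \<in> carrier_vec (nquad G m) \<Longrightarrow> mortar_ip G m x (- y) = - mortar_ip G m x y"
  unfolding mortar_ip_def sum_negf[symmetric] by (auto intro!: sum.cong)

lemma mortar_ip_minus_right:
  assumes "y \<in> carrier_vec (nquad G m)" "z \<in> carrier_vec (nquad G m)"
  shows "mortar_ip G m x (y - z) = mortar_ip G m x y - mortar_ip G m x z"
  unfolding mortar_ip_def sum_subtractf[symmetric]
  using assms by (auto simp: algebra_simps intro!: sum.cong)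

section \<open>Vector sums and adjoints\<close>

lemma vsum_carrier:
  "(\<And>a. a \<in> A \<Longrightarrow> f a \<in> carrier_vec n) \<Longrightarrow> vsum n f A \<in> carrier_vec n"
  by (rule finsum_vec_closed) auto

lemma scalar_prod_vsum:
  assumes "finite A" "\<And>a. a \<in> A \<Longrightarrow> f a \<in> carrier_vec n"
  shows "x \<bullet> vsum n f A = (\<Sum>a\<in>A. x \<bullet> f a)"
proof -
  have "dim_vec (vsum n f A) = n"
    using vsum_carrier[of A f n] assms(2) by auto
  then have "x \<bullet> vsum n f A = (\<Sum>k<n. \<Sum>a\<in>A. x $ k * f a $ k)"
    by (auto simp: scalar_prod_def lessThan_atLeast0 index_finsum_vec assms sum_distrib_left
        intro!: sum.cong)
  also have "\<dots> = (\<Sum>a\<in>A. x \<bullet> f a)"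
    by (subst sum.swap)
      (auto simp: scalar_prod_def lessThan_atLeast0 carrier_vecD[OF assms(2)] intro!: sum.cong)
  finally show ?thesis .
qed

lemma scalar_prod_transpose:
  fixes A :: "real mat"
  assumes "A \<in> carrier_mat nr nc" "x \<in> carrier_vec nc" "y \<in> carrier_vec nr"
  shows "x \<bullet> (transpose_mat A *\<^sub>v y) = (A *\<^sub>v x) \<bullet> y"
proof -
  have "x \<bullet> (transpose_mat A *\<^sub>v y) = (transpose_mat A *\<^sub>v y) \<bullet> x"
    using assms by (intro comm_scalar_prod[of _ nc] mult_mat_vec_carrier[of _ nc nr]) auto
  also have "\<dots> = y \<bullet> (A *\<^sub>v x)"
    using assms by (rule transpose_vec_mult_scalar)
  also have "\<dots> = (A *\<^sub>v x) \<bullet> y"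
    using assms by (intro comm_scalar_prod[of _ nr]) auto
  finally show ?thesis .
qed

lemma scalar_prod_mortar_term:
  assumes "P \<in> carrier_mat (nquad G m) n" "x \<in> carrier_vec n" "y \<in> carrier_vec (nquad G m)"
  shows "x \<bullet> (transpose_mat P *\<^sub>v (W_mat G m *\<^sub>v y)) = mortar_ip G m (P *\<^sub>v x) y"
proof -
  have "W_mat G m *\<^sub>v y \<in> carrier_vec (nquad G m)"
    by (intro carrier_vecI) (simp add: W_mat_def mat_diag_def)
  then show ?thesis
    using assms by (simp add: scalar_prod_transpose[of P "nquad G m" n] scalar_prod_W_mat)
qed

lemma scalar_prod_test_term:
  fixes x y z b :: "real vec"
  assumes "x \<in> carrier_vec n" "y \<in> carrier_vec n" "z \<in> carrier_vec n" "b \<in> carrier_vec n"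
  shows "(a \<cdot>\<^sub>v x) \<bullet> (h \<cdot>\<^sub>v (y + z) + b) = a * (h * (x \<bullet> y + x \<bullet> z) + x \<bullet> b)"
  using assms by (simp add: scalar_prod_add_distrib[of _ n] algebra_simps)

lemma mortar_term_carrier:
  assumes "P \<in> carrier_mat (nquad G m) n"
  shows "transpose_mat P *\<^sub>v (W_mat G m *\<^sub>v y) \<in> carrier_vec n"
  using assms by (intro carrier_vecI) simp

section \<open>Dimensions and mesh incidence\<close>

lemma normal_vec_carrier: "normal_vec G m j \<in> carrier_vec (nquad G m)"
  by (simp add: normal_vec_def)

lemma normal_from_carrier: "normal_from G m e j \<in> carrier_vec (nquad G m)"
  by (simp add: normal_from_def normal_vec_carrier)

lemma T_star_carrier: "T_star G v \<sigma> m i \<in> carrier_vec (nquad G m)"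
  by (simp add: T_star_def)

lemma v_star_carrier: "v_star G v \<sigma> m i \<in> carrier_vec (nquad G m)"
  by (simp add: v_star_def)

lemma T_star_from_carrier: "T_star_from G v \<sigma> m e i \<in> carrier_vec (nquad G m)"
  by (simp add: T_star_from_def T_star_carrier)

lemma sum_over_incidences:
  fixes f :: "'m \<Rightarrow> 'e \<Rightarrow> real"
  assumes "mesh_ok G"
  shows "(\<Sum>e\<in>elements G. \<Sum>m\<in>mortars_of G e. f m e) =
         (\<Sum>m\<in>mortars G. (\<Sum>e\<in>minus_side G m. f m e) + (\<Sum>e\<in>plus_side G m. f m e))"
proof -
  have fin: "finite (elements G)" "finite (mortars G)"
    and sub: "\<And>e. e \<in> elements G \<Longrightarrow> mortars_of G e \<subseteq> mortars G"
    and sides: "\<And>m. m \<in> mortars G \<Longrightarrow> elements_of G m = plus_side G m \<union> minus_side G m"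
      "\<And>m. m \<in> mortars G \<Longrightarrow> plus_side G m \<inter> minus_side G m = {}"
    using assms by (auto simp: mesh_ok_def)
  have "(\<Sum>e\<in>elements G. \<Sum>m\<in>mortars_of G e. f m e) =
        (\<Sum>e\<in>elements G. \<Sum>m | m \<in> mortars G \<and> m \<in> mortars_of G e. f m e)"
    using sub by (intro sum.cong) auto
  also have "\<dots> = (\<Sum>m\<in>mortars G. \<Sum>e\<in>elements_of G m. f m e)"
    unfolding elements_of_def using fin by (rule sum.swap_restrict)
  also have "\<dots> = (\<Sum>m\<in>mortars G. (\<Sum>e\<in>minus_side G m. f m e) + (\<Sum>e\<in>plus_side G m. f m e))"
  proof (intro sum.cong refl)
    fix m assume m: "m \<in> mortars G"
    have "finite (plus_side G m \<union> minus_side G m)"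
      using fin(1) unfolding sides(1)[OF m, symmetric] elements_of_def by simp
    then show "(\<Sum>e\<in>elements_of G m. f m e) =
        (\<Sum>e\<in>minus_side G m. f m e) + (\<Sum>e\<in>plus_side G m. f m e)"
      unfolding sides(1)[OF m] using sides(2)[OF m] by (subst sum.union_disjoint) auto
  qed
  finally show ?thesis .
qed

context
  fixes G :: "('e, 'm) dg" and one :: "'e \<Rightarrow> real vec"
  assumes setting: "dg_setting G"
    and one: "\<forall>e \<in> elements G. is_one_dofs G e (one e)"
begin

lemma one_carrier: "e \<in> elements G \<Longrightarrow> one e \<in> carrier_vec (ndof G e)"
  using one by (auto simp: is_one_dofs_def)

lemma incident:
  assumes "e \<in> elements G" "m \<in> mortars_of G e"
  shows "m \<in> mortars G" "e \<in> elements_of G m"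
  using assms setting by (auto simp: dg_setting_def mesh_ok_def elements_of_def)

lemma on_side:
  assumes "m \<in> mortars G" "e \<in> minus_side G m \<or> e \<in> plus_side G m"
  shows "e \<in> elements G" "m \<in> mortars_of G e"
proof -
  have "e \<in> elements_of G m"
    using assms setting by (auto simp: dg_setting_def mesh_ok_def)
  then show "e \<in> elements G" "m \<in> mortars_of G e"
    by (auto simp: elements_of_def)
qed

lemma plus_not_minus: "m \<in> mortars G \<Longrightarrow> e \<in> plus_side G m \<Longrightarrow> e \<notin> minus_side G m"
  using setting by (auto simp: dg_setting_def mesh_ok_def)

lemma finite_mortars_of: "e \<in> elements G \<Longrightarrow> finite (mortars_of G e)"
  using setting by (auto simp: dg_setting_def mesh_ok_def intro: finite_subset)

lemma finite_sides:
  assumes "m \<in> mortars G"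
  shows "finite (minus_side G m)" "finite (plus_side G m)"
proof -
  have "finite (elements G)"
    using setting by (auto simp: dg_setting_def mesh_ok_def)
  moreover have "minus_side G m \<subseteq> elements G" "plus_side G m \<subseteq> elements G"
    using on_side[OF assms] by auto
  ultimately show "finite (minus_side G m)" "finite (plus_side G m)"
    by (auto intro: finite_subset)
qed

lemma proj_carrier:
  assumes "e \<in> elements G" "m \<in> mortars_of G e"
  shows "proj G m e \<in> carrier_mat (nquad G m) (ndof G e)"
    and "nproj G m e j \<in> carrier_mat (nquad G m) (ndof G e)"
  using incident[OF assms] setting by (auto simp: dg_setting_def operators_ok_def)

lemma volume_carrier:
  assumes "e \<in> elements G"
  shows "mass_S G e i j k l \<in> carrier_mat (ndof G e) (ndof G e)"
    and "stiff G e j \<in> carrier_mat (ndof G e) (ndof G e)"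
  using assms setting by (auto simp: dg_setting_def operators_ok_def)

lemma mass_S_swap: "e \<in> elements G \<Longrightarrow> mass_S G e i j k l = mass_S G e j i k l"
  using setting by (auto simp: dg_setting_def operators_ok_def)

lemma v_elem_carrier:
  assumes "e \<in> elements G" "m \<in> mortars_of G e" "v e i \<in> carrier_vec (ndof G e)"
  shows "v_elem G v m e i \<in> carrier_vec (nquad G m)"
  using proj_carrier[OF assms(1,2)] assms(3) by (auto simp: v_elem_def)

lemma v_from_carrier:
  assumes "m \<in> mortars G" "\<forall>e \<in> elements G. \<forall>i. v e i \<in> carrier_vec (ndof G e)"
  shows "v_minus G v m i \<in> carrier_vec (nquad G m)"
    and "v_plus G v m i \<in> carrier_vec (nquad G m)"
    and "v_from G v m e i \<in> carrier_vec (nquad G m)"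
proof -
  have *: "v_elem G v m e i \<in> carrier_vec (nquad G m)"
    if "e \<in> minus_side G m \<or> e \<in> plus_side G m" for e
    using on_side[OF assms(1) that] assms(2) by (intro v_elem_carrier) auto
  show 1: "v_minus G v m i \<in> carrier_vec (nquad G m)" "v_plus G v m i \<in> carrier_vec (nquad G m)"
    using * by (auto simp: v_minus_def v_plus_def intro!: vsum_carrier)
  show "v_from G v m e i \<in> carrier_vec (nquad G m)"
    using 1 by (simp add: v_from_def)
qed

lemma T_elem_carrier:
  assumes "e \<in> elements G" "m \<in> mortars_of G e" "\<forall>i j. \<tau> e i j \<in> carrier_vec (ndof G e)"
  shows "T_elem G \<tau> m e i \<in> carrier_vec (nquad G m)"
  unfolding T_elem_def
  using assms(3) by (intro vsum_carrier mult_mat_vec_carrier[OF proj_carrier(2)[OF assms(1,2)]]) auto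

section \<open>Balances on one element\<close>

text \<open>
  Moving the stiffness matrix from the stress to the constant makes the stress term vanish, so the momentum of an element
  changes only through its boundary.
\<close>

lemma element_momentum_balance:
  assumes e: "e \<in> elements G"
    and stiff_one: "\<forall>j. stiff G e j *\<^sub>v one e = 0\<^sub>v (ndof G e)"
    and s: "\<And>j. s j \<in> carrier_vec (ndof G e)"
    and T: "\<And>m. T m \<in> carrier_vec (nquad G m)"
  shows "one e \<bullet>
      (- vsum (ndof G e) (\<lambda>j. transpose_mat (stiff G e j) *\<^sub>v s j) (UNIV :: 3 set)
       + vsum (ndof G e) (\<lambda>m. transpose_mat (proj G m e) *\<^sub>v (W_mat G m *\<^sub>v T m)) (mortars_of G e))
    = (\<Sum>m\<in>mortars_of G e. mortar_ip G m (proj G m e *\<^sub>v one e) (T m))"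
proof -
  have c1: "transpose_mat (stiff G e j) *\<^sub>v s j \<in> carrier_vec (ndof G e)" for j
    using volume_carrier(2)[OF e, of j] by (intro carrier_vecI) auto
  have c2: "transpose_mat (proj G m e) *\<^sub>v (W_mat G m *\<^sub>v T m) \<in> carrier_vec (ndof G e)"
    if "m \<in> mortars_of G e" for m
    using proj_carrier(1)[OF e that] by (rule mortar_term_carrier)
  have A: "vsum (ndof G e) (\<lambda>j. transpose_mat (stiff G e j) *\<^sub>v s j) (UNIV :: 3 set)
      \<in> carrier_vec (ndof G e)" (is "?A \<in> _")
    using c1 by (auto intro!: vsum_carrier)
  have B: "vsum (ndof G e) (\<lambda>m. transpose_mat (proj G m e) *\<^sub>v (W_mat G m *\<^sub>v T m)) (mortars_of G e)
      \<in> carrier_vec (ndof G e)" (is "?B \<in> _")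
    using c2 by (auto intro!: vsum_carrier)
  have "one e \<bullet> ?A = 0"
  proof -
    have "one e \<bullet> (transpose_mat (stiff G e j) *\<^sub>v s j) = 0" for j
      using scalar_prod_transpose[OF volume_carrier(2)[OF e] one_carrier[OF e] s, of j j] stiff_one s[of j]
      by simp
    then show ?thesis
      using c1 by (simp add: scalar_prod_vsum)
  qed
  moreover have "one e \<bullet> ?B = (\<Sum>m\<in>mortars_of G e. mortar_ip G m (proj G m e *\<^sub>v one e) (T m))"
    using proj_carrier(1)[OF e] one_carrier[OF e] T
    by (subst scalar_prod_vsum[OF finite_mortars_of[OF e] c2])
      (auto intro!: sum.cong scalar_prod_mortar_term)
  moreover have "one e \<bullet> (- ?A + ?B) = - (one e \<bullet> ?A) + one e \<bullet> ?B"
    using A B one_carrier[OF e] by (simp add: scalar_prod_add_distrib[of _ "ndof G e"])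
  ultimately show ?thesis
    by simp
qed

lemma one_stiff_boundary:
  assumes e: "e \<in> elements G"
    and div: "transpose_mat (stiff G e j) *\<^sub>v one e =
         vsum (ndof G e)
           (\<lambda>m. transpose_mat (proj G m e) *\<^sub>v (W_mat G m *\<^sub>v normal_from G m e j))
           (mortars_of G e)"
    and u: "u \<in> carrier_vec (ndof G e)"
  shows "one e \<bullet> (stiff G e j *\<^sub>v u) =
    (\<Sum>m\<in>mortars_of G e. mortar_ip G m (normal_from G m e j) (proj G m e *\<^sub>v u))"
proof -
  have "one e \<bullet> (stiff G e j *\<^sub>v u) = (transpose_mat (stiff G e j) *\<^sub>v one e) \<bullet> u"
    using volume_carrier(2)[OF e, of j] one_carrier[OF e] u
    by (simp add: transpose_vec_mult_scalar)
  also have "\<dots> = u \<bullet> (transpose_mat (stiff G e j) *\<^sub>v one e)"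
    using volume_carrier(2)[OF e, of j] one_carrier[OF e] u
    by (intro comm_scalar_prod[of _ "ndof G e"] mult_mat_vec_carrier[of _ _ "ndof G e"]) auto
  also have "\<dots> = (\<Sum>m\<in>mortars_of G e. mortar_ip G m (proj G m e *\<^sub>v u) (normal_from G m e j))"
    unfolding div using proj_carrier(1)[OF e] u normal_from_carrier
    by (subst scalar_prod_vsum[OF finite_mortars_of[OF e] mortar_term_carrier[OF proj_carrier(1)[OF e]]])
      (auto intro!: sum.cong scalar_prod_mortar_term)
  finally show ?thesis
    by (simp add: mortar_ip_commute)
qed

text \<open>
  The constant test tensor \<open>c\<close> turns the symmetric gradient into \<open>c i j\<close> times \<open>\<integral> \<partial>v\<^sub>i/\<partial>x\<^sub>j\<close>, which the
  divergence theorem moves to the boundary, and the flux correction into a pairing with the traction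
  of the constant stress \<open>c\<close>.
\<close>

lemma element_strain_balance:
  fixes c :: "3 \<Rightarrow> 3 \<Rightarrow> real"
  assumes e: "e \<in> elements G"
    and div: "\<forall>j. transpose_mat (stiff G e j) *\<^sub>v one e =
         vsum (ndof G e)
           (\<lambda>m. transpose_mat (proj G m e) *\<^sub>v (W_mat G m *\<^sub>v normal_from G m e j))
           (mortars_of G e)"
    and c: "\<forall>i j. c i j = c j i"
    and v: "\<forall>i. v e i \<in> carrier_vec (ndof G e)"
    and w: "\<And>m i. m \<in> mortars_of G e \<Longrightarrow> w m i \<in> carrier_vec (nquad G m)"
  shows "(\<Sum>i\<in>UNIV. \<Sum>j\<in>UNIV. (c i j \<cdot>\<^sub>v one e) \<bullet>
       ((1 / 2) \<cdot>\<^sub>v (stiff G e j *\<^sub>v v e i + stiff G e i *\<^sub>v v e j)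
        + vsum (ndof G e) (\<lambda>m. transpose_mat (nproj G m e j) *\<^sub>v (W_mat G m *\<^sub>v w m i)) (mortars_of G e)))
     = (\<Sum>m\<in>mortars_of G e. \<Sum>i\<in>UNIV.
         mortar_ip G m (vsum (nquad G m) (\<lambda>j. c i j \<cdot>\<^sub>v normal_from G m e j) UNIV) (v_elem G v m e i)
         + mortar_ip G m (T_elem G (\<lambda>e i j. c i j \<cdot>\<^sub>v one e) m e i) (w m i))"
proof -
  let ?g = "\<lambda>i j. one e \<bullet> (stiff G e j *\<^sub>v v e i)"
  let ?B = "\<lambda>i j. vsum (ndof G e) (\<lambda>m. transpose_mat (nproj G m e j) *\<^sub>v (W_mat G m *\<^sub>v w m i))
              (mortars_of G e)"
  let ?h = "\<lambda>m i j. mortar_ip G m (nproj G m e j *\<^sub>v one e) (w m i)"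
  note oc = one_carrier[OF e]
  have sc: "stiff G e j *\<^sub>v v e i \<in> carrier_vec (ndof G e)" for i j
    using volume_carrier(2)[OF e, of j] v by auto
  have c2: "transpose_mat (nproj G m e j) *\<^sub>v (W_mat G m *\<^sub>v w m i) \<in> carrier_vec (ndof G e)"
    if "m \<in> mortars_of G e" for m i j
    using proj_carrier(2)[OF e that] by (rule mortar_term_carrier)
  have Bc: "?B i j \<in> carrier_vec (ndof G e)" for i j
    using c2 by (auto intro!: vsum_carrier)
  have B: "one e \<bullet> ?B i j = (\<Sum>m\<in>mortars_of G e. ?h m i j)" for i j
    using proj_carrier(2)[OF e] oc w
    by (subst scalar_prod_vsum[OF finite_mortars_of[OF e] c2])
      (auto intro!: sum.cong scalar_prod_mortar_term)
  \<comment> \<open>The second half is written with \<open>c j i\<close>, so that exchanging \<open>i\<close> and \<open>j\<close> in the double sum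
    turns it into the first half.\<close>
  have summand: "(c i j \<cdot>\<^sub>v one e) \<bullet>
       ((1 / 2) \<cdot>\<^sub>v (stiff G e j *\<^sub>v v e i + stiff G e i *\<^sub>v v e j) + ?B i j)
      = (c i j * ?g i j / 2 + c j i * ?g j i / 2) + c i j * (\<Sum>m\<in>mortars_of G e. ?h m i j)" for i j
  proof -
    have "(c i j \<cdot>\<^sub>v one e) \<bullet>
       ((1 / 2) \<cdot>\<^sub>v (stiff G e j *\<^sub>v v e i + stiff G e i *\<^sub>v v e j) + ?B i j)
       = c i j * (1 / 2 * (?g i j + ?g j i) + one e \<bullet> ?B i j)"
      by (rule scalar_prod_test_term[OF oc sc sc Bc])
    then show ?thesis
      using c by (simp add: B algebra_simps)
  qed
  have "(\<Sum>i\<in>UNIV. \<Sum>j\<in>UNIV. (c i j \<cdot>\<^sub>v one e) \<bullet>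
       ((1 / 2) \<cdot>\<^sub>v (stiff G e j *\<^sub>v v e i + stiff G e i *\<^sub>v v e j) + ?B i j))
      = (\<Sum>i\<in>UNIV. \<Sum>j\<in>UNIV. c i j * ?g i j / 2) + (\<Sum>i\<in>UNIV. \<Sum>j\<in>UNIV. c j i * ?g j i / 2)
        + (\<Sum>i\<in>UNIV. \<Sum>j\<in>UNIV. c i j * (\<Sum>m\<in>mortars_of G e. ?h m i j))"
    unfolding summand by (simp add: sum.distrib)
  also have "(\<Sum>i\<in>UNIV. \<Sum>j\<in>UNIV. c j i * ?g j i / 2) = (\<Sum>i\<in>UNIV. \<Sum>j\<in>UNIV. c i j * ?g i j / 2)"
    by (rule sum.swap)
  also have "(\<Sum>i\<in>UNIV. \<Sum>j\<in>UNIV. c i j * ?g i j / 2) + (\<Sum>i\<in>UNIV. \<Sum>j\<in>UNIV. c i j * ?g i j / 2)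
      = (\<Sum>i\<in>UNIV. \<Sum>j\<in>UNIV. c i j * ?g i j)"
    by (simp add: sum.distrib[symmetric])
  also have "(\<Sum>i\<in>UNIV. \<Sum>j\<in>UNIV. c i j * ?g i j) = (\<Sum>i\<in>UNIV. \<Sum>j\<in>UNIV. \<Sum>m\<in>mortars_of G e.
        c i j * mortar_ip G m (normal_from G m e j) (v_elem G v m e i))"
    using div v by (simp add: one_stiff_boundary[OF e] v_elem_def sum_distrib_left)
  also have "\<dots> = (\<Sum>m\<in>mortars_of G e. \<Sum>i\<in>UNIV. \<Sum>j\<in>UNIV.
        c i j * mortar_ip G m (normal_from G m e j) (v_elem G v m e i))"
    by (simp only: sum.swap[of _ UNIV "mortars_of G e"])
  also have "(\<Sum>i\<in>UNIV. \<Sum>j\<in>UNIV. c i j * (\<Sum>m\<in>mortars_of G e. ?h m i j))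
      = (\<Sum>m\<in>mortars_of G e. \<Sum>i\<in>UNIV. \<Sum>j\<in>UNIV. c i j * ?h m i j)"
    by (simp only: sum_distrib_left sum.swap[of _ UNIV "mortars_of G e"])
  also have "(\<Sum>m\<in>mortars_of G e. \<Sum>i\<in>UNIV. \<Sum>j\<in>UNIV.
        c i j * mortar_ip G m (normal_from G m e j) (v_elem G v m e i)) +
      (\<Sum>m\<in>mortars_of G e. \<Sum>i\<in>UNIV. \<Sum>j\<in>UNIV. c i j * ?h m i j)
      = (\<Sum>m\<in>mortars_of G e. \<Sum>i\<in>UNIV.
         mortar_ip G m (vsum (nquad G m) (\<lambda>j. c i j \<cdot>\<^sub>v normal_from G m e j) UNIV) (v_elem G v m e i)
         + mortar_ip G m (T_elem G (\<lambda>e i j. c i j \<cdot>\<^sub>v one e) m e i) (w m i))"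
    unfolding sum.distrib[symmetric]
  proof (intro sum.cong refl)
    fix m and i :: 3 assume m: "m \<in> mortars_of G e"
    have "nproj G m e j *\<^sub>v (c i j \<cdot>\<^sub>v one e) = c i j \<cdot>\<^sub>v (nproj G m e j *\<^sub>v one e)" for j
      using proj_carrier(2)[OF e m] oc by (rule mult_mat_vec)
    moreover have "nproj G m e j *\<^sub>v one e \<in> carrier_vec (nquad G m)" for j
      using proj_carrier(2)[OF e m] oc by (rule mult_mat_vec_carrier)
    ultimately show "(\<Sum>j\<in>UNIV. c i j * mortar_ip G m (normal_from G m e j) (v_elem G v m e i)
          + c i j * ?h m i j)
      = mortar_ip G m (vsum (nquad G m) (\<lambda>j. c i j \<cdot>\<^sub>v normal_from G m e j) UNIV) (v_elem G v m e i)
         + mortar_ip G m (T_elem G (\<lambda>e i j. c i j \<cdot>\<^sub>v one e) m e i) (w m i)"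
      unfolding T_elem_def
      by (simp add: mortar_ip_vsum_left mortar_ip_smult_left normal_from_carrier sum.distrib)
  qed
  finally show ?thesis .
qed

section \<open>Cancellation on one mortar\<close>

lemma mortar_momentum_cancels:
  assumes m: "m \<in> mortars G"
    and proj_one: "vsum (nquad G m) (\<lambda>e. proj G m e *\<^sub>v one e) (minus_side G m) =
        vsum (nquad G m) (\<lambda>e. proj G m e *\<^sub>v one e) (plus_side G m)"
  shows "(\<Sum>e\<in>minus_side G m. mortar_ip G m (proj G m e *\<^sub>v one e) (T_star_from G v \<sigma> m e i)) +
      (\<Sum>e\<in>plus_side G m. mortar_ip G m (proj G m e *\<^sub>v one e) (T_star_from G v \<sigma> m e i)) = 0"
proof -
  let ?T = "T_star G v \<sigma> m i"
  have pc: "proj G m e *\<^sub>v one e \<in> carrier_vec (nquad G m)"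
    if "e \<in> minus_side G m \<or> e \<in> plus_side G m" for e
    using proj_carrier(1)[OF on_side[OF m that]] one_carrier[OF on_side(1)[OF m that]] by simp
  have "(\<Sum>e\<in>minus_side G m. mortar_ip G m (proj G m e *\<^sub>v one e) (T_star_from G v \<sigma> m e i)) =
      mortar_ip G m (vsum (nquad G m) (\<lambda>e. proj G m e *\<^sub>v one e) (minus_side G m)) ?T"
    using pc by (simp add: mortar_ip_vsum_left finite_sides[OF m] T_star_from_def)
  moreover have "(\<Sum>e\<in>plus_side G m. mortar_ip G m (proj G m e *\<^sub>v one e) (T_star_from G v \<sigma> m e i)) =
      - mortar_ip G m (vsum (nquad G m) (\<lambda>e. proj G m e *\<^sub>v one e) (plus_side G m)) ?T"
    using pc plus_not_minus[OF m]
    by (simp add: mortar_ip_vsum_left finite_sides[OF m] T_star_from_def mortar_ip_uminus_right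
        T_star_carrier sum_negf)
  ultimately show ?thesis
    using proj_one by simp
qed

text \<open>
  Each side contributes plus or minus the pairing of the common traction with \<open>v\<^sub>i\<^sup>*\<close>: the term from the
  divergence theorem compensates exactly the interior velocity in the flux correction.
\<close>

lemma mortar_strain_cancels:
  fixes c :: "3 \<Rightarrow> 3 \<Rightarrow> real" and i :: 3 and v :: "'e velocity" and \<sigma> :: "'e stress"
  defines "\<tau> \<equiv> \<lambda>e i j. c i j \<cdot>\<^sub>v one e"
  defines "F \<equiv> \<lambda>m e i.
         mortar_ip G m (vsum (nquad G m) (\<lambda>j. c i j \<cdot>\<^sub>v normal_from G m e j) UNIV) (v_elem G v m e i)
         + mortar_ip G m (T_elem G \<tau> m e i) (v_star G v \<sigma> m i - v_from G v m e i)"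
  assumes m: "m \<in> mortars G"
    and v: "\<forall>e \<in> elements G. \<forall>i. v e i \<in> carrier_vec (ndof G e)"
    and traction: "T_minus G \<tau> m i = vsum (nquad G m) (\<lambda>j. c i j \<cdot>\<^sub>v normal_vec G m j) UNIV"
      "T_plus G \<tau> m i = vsum (nquad G m) (\<lambda>j. c i j \<cdot>\<^sub>v normal_vec G m j) UNIV"
  shows "(\<Sum>e\<in>minus_side G m. F m e i) + (\<Sum>e\<in>plus_side G m. F m e i) = 0"
proof -
  let ?N = "vsum (nquad G m) (\<lambda>j. c i j \<cdot>\<^sub>v normal_vec G m j) UNIV"
  let ?ip = "mortar_ip G m"
  let ?vs = "v_star G v \<sigma> m i"
  have Nc: "?N \<in> carrier_vec (nquad G m)"
    by (auto intro!: vsum_carrier simp: normal_vec_carrier)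
  have vc: "v_elem G v m e i \<in> carrier_vec (nquad G m)"
    and tc: "T_elem G \<tau> m e i \<in> carrier_vec (nquad G m)"
    if "e \<in> minus_side G m \<or> e \<in> plus_side G m" for e
    using on_side[OF m that] v one_carrier
    by (auto intro!: v_elem_carrier T_elem_carrier simp: \<tau>_def)
  note sides = v_from_carrier[OF m v] v_star_carrier
  have N_plus: "?ip (vsum (nquad G m) (\<lambda>j. c i j \<cdot>\<^sub>v normal_from G m e j) UNIV) y = - ?ip ?N y"
    if "e \<in> plus_side G m" for e y
    using plus_not_minus[OF m that]
    by (simp add: mortar_ip_vsum_left normal_from_def normal_vec_carrier mortar_ip_smult_left
        mortar_ip_uminus_left sum_negf)
  have N_minus: "vsum (nquad G m) (\<lambda>j. c i j \<cdot>\<^sub>v normal_from G m e j) UNIV = ?N"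
    if "e \<in> minus_side G m" for e
    using that by (simp add: normal_from_def)
  have "(\<Sum>e\<in>minus_side G m. F m e i) =
      (\<Sum>e\<in>minus_side G m. ?ip ?N (v_elem G v m e i)) +
      (\<Sum>e\<in>minus_side G m. ?ip (T_elem G \<tau> m e i) (?vs - v_minus G v m i))"
    unfolding F_def sum.distrib[symmetric]
    by (intro sum.cong refl) (simp add: N_minus v_from_def)
  also have "\<dots> = ?ip ?N (v_minus G v m i) + ?ip (T_minus G \<tau> m i) (?vs - v_minus G v m i)"
    using vc tc by (simp add: v_minus_def T_minus_def mortar_ip_vsum_left mortar_ip_vsum_right
        finite_sides[OF m])
  also have "\<dots> = ?ip ?N ?vs"
    unfolding traction by (simp add: mortar_ip_minus_right sides)
  finally have minus: "(\<Sum>e\<in>minus_side G m. F m e i) = ?ip ?N ?vs" .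
  have "(\<Sum>e\<in>plus_side G m. F m e i) =
      - (\<Sum>e\<in>plus_side G m. ?ip ?N (v_elem G v m e i)) +
      (\<Sum>e\<in>plus_side G m. ?ip (T_elem G \<tau> m e i) (?vs - v_plus G v m i))"
    unfolding F_def sum_negf[symmetric] sum.distrib[symmetric]
    by (intro sum.cong refl) (simp add: N_plus v_from_def plus_not_minus[OF m])
  also have "\<dots> = - ?ip ?N (v_plus G v m i) - ?ip (T_plus G \<tau> m i) (?vs - v_plus G v m i)"
    using vc tc by (simp add: v_plus_def T_plus_def mortar_ip_uminus_left vsum_carrier
        mortar_ip_vsum_left mortar_ip_vsum_right finite_sides[OF m])
  also have "\<dots> = - ?ip ?N ?vs"
    unfolding traction by (simp add: mortar_ip_minus_right sides)
  finally show ?thesis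
    using minus by simp
qed

text \<open>
  The test functions must be symmetric, so a single strain component is reached only through the
  symmetrized unit tensor; the symmetry of the compliance in its first index pair makes both halves equal.
\<close>

lemma unit_strain_test:
  fixes p q :: 3 and s :: "3 \<Rightarrow> 3 \<Rightarrow> real vec"
  defines "c \<equiv> \<lambda>i j. (of_bool (i = p \<and> j = q) + of_bool (i = q \<and> j = p)) / 2"
  assumes e: "e \<in> elements G" and s: "\<forall>k l. s k l \<in> carrier_vec (ndof G e)"
  shows "(\<Sum>i\<in>UNIV. \<Sum>j\<in>UNIV. \<Sum>k\<in>UNIV. \<Sum>l\<in>UNIV.
      (c i j \<cdot>\<^sub>v one e) \<bullet> (mass_S G e i j k l *\<^sub>v s k l)) =
    (\<Sum>k\<in>UNIV. \<Sum>l\<in>UNIV. one e \<bullet> (mass_S G e p q k l *\<^sub>v s k l))"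
proof -
  define M where "M i j = (\<Sum>k\<in>UNIV. \<Sum>l\<in>UNIV. one e \<bullet> (mass_S G e i j k l *\<^sub>v s k l))" for i j
  have unit: "(\<Sum>i\<in>UNIV. \<Sum>j\<in>UNIV. of_bool (i = a \<and> j = b) * M i j) = M a b" for a b
  proof -
    have "(\<Sum>j\<in>UNIV. of_bool (i = a \<and> j = b) * M i j) = (if i = a then M a b else 0)" for i
      by (cases "i = a") (simp_all add: of_bool_def if_distrib[of "\<lambda>x. x * _"] cong: if_cong)
    then show ?thesis
      by simp
  qed
  have "(c i j \<cdot>\<^sub>v one e) \<bullet> (mass_S G e i j k l *\<^sub>v s k l) =
      c i j * (one e \<bullet> (mass_S G e i j k l *\<^sub>v s k l))" for i j k l
    using one_carrier[OF e] volume_carrier(1)[OF e, of i j k l] s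
    by (intro smult_scalar_prod_distrib[of _ "ndof G e"]) auto
  then have "(\<Sum>i\<in>UNIV. \<Sum>j\<in>UNIV. \<Sum>k\<in>UNIV. \<Sum>l\<in>UNIV.
      (c i j \<cdot>\<^sub>v one e) \<bullet> (mass_S G e i j k l *\<^sub>v s k l)) = (\<Sum>i\<in>UNIV. \<Sum>j\<in>UNIV. c i j * M i j)"
    by (simp add: M_def sum_distrib_left)
  also have "\<dots> = ((\<Sum>i\<in>UNIV. \<Sum>j\<in>UNIV. of_bool (i = p \<and> j = q) * M i j) +
      (\<Sum>i\<in>UNIV. \<Sum>j\<in>UNIV. of_bool (i = q \<and> j = p) * M i j)) / 2"
    unfolding c_def sum.distrib[symmetric] sum_divide_distrib
    by (intro sum.cong refl) (simp add: algebra_simps)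
  also have "\<dots> = (M p q + M q p) / 2"
    by (simp only: unit)
  also have "M q p = M p q"
    unfolding M_def by (simp only: mass_S_swap[OF e, of q p])
  finally show ?thesis
    by (simp add: M_def)
qed

end

section \<open>Conservation\<close>

theorem mainTheorem6:
  fixes G :: "('e, 'm) dg"
    and one :: "'e \<Rightarrow> real vec"
    and I :: "real set"
    and v v' :: "real \<Rightarrow> 'e \<Rightarrow> 3 \<Rightarrow> real vec"
    and \<sigma> \<sigma>' :: "real \<Rightarrow> 'e \<Rightarrow> 3 \<Rightarrow> 3 \<Rightarrow> real vec"
  assumes setting: "dg_setting G"
    and periodic: "no_boundary_mortars G"
    and volume_constants: "\<forall>e \<in> elements G. is_one_dofs G e (one e)"
    and mortar_constants: "\<forall>m \<in> mortars G. mortar_space_has_constants G m"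
    and projection_consistency:
      "\<forall>m \<in> mortars G.
         vsum (nquad G m) (\<lambda>e. proj G m e *\<^sub>v one e) (minus_side G m) = one_mortar G m \<and>
         vsum (nquad G m) (\<lambda>e. proj G m e *\<^sub>v one e) (plus_side G m) = one_mortar G m"
    and stiffness_consistency:
      "\<forall>e \<in> elements G. \<forall>j. stiff G e j *\<^sub>v one e = 0\<^sub>v (ndof G e)"
    and flux_consistency: "consistent_flux G"
    and divergence_theorem:
      "\<forall>e \<in> elements G. \<forall>j.
         transpose_mat (stiff G e j) *\<^sub>v one e =
         vsum (ndof G e)
           (\<lambda>m. transpose_mat (proj G m e) *\<^sub>v (W_mat G m *\<^sub>v normal_from G m e j))
           (mortars_of G e)"
    and constant_traction:
      "\<forall>m \<in> mortars G. \<forall>(c :: 3 \<Rightarrow> 3 \<Rightarrow> real) (\<tau> :: 'e \<Rightarrow> 3 \<Rightarrow> 3 \<Rightarrow> real vec).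
         (\<forall>i j. c i j = c j i) \<and>
         (\<forall>e \<in> elements_of G m. \<forall>i j. \<tau> e i j = c i j \<cdot>\<^sub>v one e) \<longrightarrow>
         (\<forall>i. T_minus G \<tau> m i = vsum (nquad G m) (\<lambda>j. c i j \<cdot>\<^sub>v normal_vec G m j) UNIV \<and>
              T_plus G \<tau> m i = vsum (nquad G m) (\<lambda>j. c i j \<cdot>\<^sub>v normal_vec G m j) UNIV)"
    and solution: "is_dg_solution G I v v' \<sigma> \<sigma>'"
  shows "\<forall>t \<in> I.
     (\<forall>i. (\<Sum>e \<in> elements G. one e \<bullet> (mass_rho G e *\<^sub>v v' t e i)) = 0) \<and>
     (\<forall>i j. (\<Sum>e \<in> elements G. \<Sum>k \<in> UNIV. \<Sum>l \<in> UNIV.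
               one e \<bullet> (mass_S G e i j k l *\<^sub>v \<sigma>' t e k l)) = 0)"
proof (intro ballI conjI allI)
  fix t and i :: 3 assume t: "t \<in> I"
  note mesh = setting[unfolded dg_setting_def, THEN conjunct1]
  have \<sigma>_carrier: "\<sigma> t e i j \<in> carrier_vec (ndof G e)" if "e \<in> elements G" for e i j
    using solution t that by (auto simp: is_dg_solution_def has_vec_derivative_on_def)
  have "one e \<bullet> (mass_rho G e *\<^sub>v v' t e i) = (\<Sum>m\<in>mortars_of G e.
      mortar_ip G m (proj G m e *\<^sub>v one e) (T_star_from G (v t) (\<sigma> t) m e i))"
    if e: "e \<in> elements G" for e
  proof -
    have "mass_rho G e *\<^sub>v v' t e i =
             - vsum (ndof G e) (\<lambda>j. transpose_mat (stiff G e j) *\<^sub>v \<sigma> t e i j) UNIV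
             + vsum (ndof G e)
                 (\<lambda>m. transpose_mat (proj G m e) *\<^sub>v (W_mat G m *\<^sub>v T_star_from G (v t) (\<sigma> t) m e i))
                 (mortars_of G e)"
      using solution e t by (simp add: is_dg_solution_def)
    then show ?thesis
      using element_momentum_balance[OF setting volume_constants e, of "\<lambda>j. \<sigma> t e i j"
          "\<lambda>m. T_star_from G (v t) (\<sigma> t) m e i"] stiffness_consistency e \<sigma>_carrier
      by (simp add: T_star_from_carrier)
  qed
  then have "(\<Sum>e \<in> elements G. one e \<bullet> (mass_rho G e *\<^sub>v v' t e i)) =
      (\<Sum>e \<in> elements G. \<Sum>m\<in>mortars_of G e.
        mortar_ip G m (proj G m e *\<^sub>v one e) (T_star_from G (v t) (\<sigma> t) m e i))"
    by simp
  also have "\<dots> = 0"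
    unfolding sum_over_incidences[OF mesh]
    using projection_consistency mortar_momentum_cancels[OF setting volume_constants]
    by (intro sum.neutral) auto
  finally show "(\<Sum>e \<in> elements G. one e \<bullet> (mass_rho G e *\<^sub>v v' t e i)) = 0" .
next
  fix t and p q :: 3 assume t: "t \<in> I"
  note mesh = setting[unfolded dg_setting_def, THEN conjunct1]
  have v_carrier: "\<forall>e \<in> elements G. \<forall>i. v t e i \<in> carrier_vec (ndof G e)"
    and \<sigma>'_carrier: "\<And>e. e \<in> elements G \<Longrightarrow> \<forall>k l. \<sigma>' t e k l \<in> carrier_vec (ndof G e)"
    using solution t by (auto simp: is_dg_solution_def has_vec_derivative_on_def)
  define c :: "3 \<Rightarrow> 3 \<Rightarrow> real"
    where "c i j = (of_bool (i = p \<and> j = q) + of_bool (i = q \<and> j = p)) / 2" for i j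
  have c_sym: "\<forall>i j. c i j = c j i"
    unfolding c_def by (simp add: add.commute conj_commute)
  define F where "F m e i =
       mortar_ip G m (vsum (nquad G m) (\<lambda>j. c i j \<cdot>\<^sub>v normal_from G m e j) UNIV) (v_elem G (v t) m e i)
       + mortar_ip G m (T_elem G (\<lambda>e i j. c i j \<cdot>\<^sub>v one e) m e i)
           (v_star G (v t) (\<sigma> t) m i - v_from G (v t) m e i)" for m e i
  have elem: "(\<Sum>k \<in> UNIV. \<Sum>l \<in> UNIV. one e \<bullet> (mass_S G e p q k l *\<^sub>v \<sigma>' t e k l)) =
      (\<Sum>m\<in>mortars_of G e. \<Sum>i\<in>UNIV. F m e i)" if e: "e \<in> elements G" for e
  proof -
    note strain_equation = solution[unfolded is_dg_solution_def, THEN conjunct2, THEN bspec, OF e,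
        THEN conjunct2, THEN conjunct2, THEN conjunct2, THEN conjunct2, THEN bspec, OF t,
        THEN spec[of _ "\<lambda>i j. c i j \<cdot>\<^sub>v one e"]]
    have "(\<Sum>k \<in> UNIV. \<Sum>l \<in> UNIV. one e \<bullet> (mass_S G e p q k l *\<^sub>v \<sigma>' t e k l)) =
       (\<Sum>i\<in>UNIV. \<Sum>j\<in>UNIV. \<Sum>k\<in>UNIV. \<Sum>l\<in>UNIV.
          (c i j \<cdot>\<^sub>v one e) \<bullet> (mass_S G e i j k l *\<^sub>v \<sigma>' t e k l))"
      unfolding c_def by (rule unit_strain_test[OF setting volume_constants e \<sigma>'_carrier[OF e], symmetric])
    also have "\<dots> = (\<Sum>i \<in> UNIV. \<Sum>j \<in> UNIV. (c i j \<cdot>\<^sub>v one e) \<bullet>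
                ((1 / 2) \<cdot>\<^sub>v (stiff G e j *\<^sub>v v t e i + stiff G e i *\<^sub>v v t e j)
                 + vsum (ndof G e)
                     (\<lambda>m. transpose_mat (nproj G m e j) *\<^sub>v
                            (W_mat G m *\<^sub>v (v_star G (v t) (\<sigma> t) m i - v_from G (v t) m e i)))
                     (mortars_of G e)))"
    proof (rule strain_equation[THEN mp])
      show "\<forall>i j. c i j \<cdot>\<^sub>v one e \<in> carrier_vec (ndof G e) \<and> c i j \<cdot>\<^sub>v one e = c j i \<cdot>\<^sub>v one e"
        using c_sym one_carrier[OF setting volume_constants e] by simp
    qed
    also have "\<dots> = (\<Sum>m\<in>mortars_of G e. \<Sum>i\<in>UNIV. F m e i)"
      unfolding F_def
    proof (rule element_strain_balance[OF setting volume_constants e _ c_sym])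
      show "v_star G (v t) (\<sigma> t) m i - v_from G (v t) m e i \<in> carrier_vec (nquad G m)"
        if "m \<in> mortars_of G e" for m i
        by (rule minus_carrier_vec[OF v_star_carrier v_from_carrier(3)[OF setting volume_constants
            incident(1)[OF setting volume_constants e that] v_carrier]])
      show "\<forall>j. transpose_mat (stiff G e j) *\<^sub>v one e = vsum (ndof G e)
           (\<lambda>m. transpose_mat (proj G m e) *\<^sub>v (W_mat G m *\<^sub>v normal_from G m e j)) (mortars_of G e)"
        using divergence_theorem e by (rule bspec)
      show "\<forall>i. v t e i \<in> carrier_vec (ndof G e)"
        using v_carrier e by (rule bspec)
    qed
    finally show ?thesis .
  qed
  have zero: "(\<Sum>e\<in>minus_side G m. F m e i) + (\<Sum>e\<in>plus_side G m. F m e i) = 0"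
    if m: "m \<in> mortars G" for m i
  proof -
    note traction = constant_traction[THEN bspec, OF m, THEN spec[of _ c],
        THEN spec[of _ "\<lambda>e i j. c i j \<cdot>\<^sub>v one e"], THEN mp, THEN spec[of _ i]]
    show ?thesis
      unfolding F_def
      by (rule mortar_strain_cancels[OF setting volume_constants m v_carrier
            traction[THEN conjunct1] traction[THEN conjunct2]]) (use c_sym in simp_all)
  qed
  have "(\<Sum>e\<in>minus_side G m. \<Sum>i\<in>UNIV. F m e i) + (\<Sum>e\<in>plus_side G m. \<Sum>i\<in>UNIV. F m e i) = 0"
    if m: "m \<in> mortars G" for m
    by (simp only: sum.swap[of _ UNIV "minus_side G m"] sum.swap[of _ UNIV "plus_side G m"]
        sum.distrib[symmetric] zero[OF m] sum.neutral_const)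
  then have "(\<Sum>e \<in> elements G. \<Sum>m\<in>mortars_of G e. \<Sum>i\<in>UNIV. F m e i) = 0"
    unfolding sum_over_incidences[OF mesh] by simp
  then show "(\<Sum>e \<in> elements G. \<Sum>k \<in> UNIV. \<Sum>l \<in> UNIV.
               one e \<bullet> (mass_S G e p q k l *\<^sub>v \<sigma>' t e k l)) = 0"
    by (simp add: elem)
qed

end
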